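(* Let $B$ be a skew brace with property (S). The following statements are equivalent: (1) $B$ is finitely generated (as a skew brace); (2) the group $(B,+)$ is finitely generated; (3) the group $(B,\circ)$ is finitely generated.
   Context: A skew (left) brace is a triple $(B,+,\circ)$ where $(B,+)$ and $(B,\circ)$ are (not necessarily abelian) groups such that $a\circ(b+c)=a\circ b-a+a\circ c$ for all $a,b,c\in B$. The two identities coincide and are denoted $0$. Put $\lambda_a(b)=-a+a\circ b$ and $a\ast b=\lambda_a(b)-b=-a+a\circ b-b$. For $x\in B$ let $\operatorname{Fix}^r(x)=\{b\in B: x\ast b=0\}$ (a subgroup of $(B,+)$), $\operatorname{Fix}^l(x)=\{b\in B: b\ast x=0\}$ (a subgroup of $(B,\circ)$), and let $C_x^+$, $C_x^\circ$ be the centralisers of $x$ in $(B,+)$ and $(B,\circ)$. An element $x$ has property (s) if the indices $|(B,+):\operatorname{Fix}^r(x)\cap C_x^+|$ and $|(B,\circ):\operatorname{Fix}^l(x)\cap C_x^\circ|$ are both finite. $B$ has property (S) if all its elements have property (s). A sub-skew brace of $B$ is a subset that is a subgroup of both $(B,+)$ and $(B,\circ)$. $B$ is finitely generated if there is a finite subset $E\subseteq B$ such that $B$ is the smallest sub-skew brace of $B$ containing $E$. *)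

theory Defs
  imports "HOL-Algebra.Algebra"
begin

text \<open>
  A skew brace is carried by the library's record \<^typ>\<open>'a ring\<close>, used purely as a signature:
  \<open>\<oplus>\<close> is the (not necessarily commutative) addition and \<open>\<otimes>\<close> is the circle operation
  \<open>\<circ>\<close>. The additive group is \<^term>\<open>add_monoid B\<close>, the circle group is \<^term>\<open>B\<close> itself.
  The record has separate fields \<open>\<zero>\<close> and \<open>\<one>\<close> for the two identities; that they coincide is
  not assumed but proved in \<open>one_eq_zero\<close> below.
\<close>

locale skew_brace = add: group "add_monoid B" + group B
  for B :: "('a, 'm) ring_scheme" (structure) +
  assumes brace_distrib:
    "\<lbrakk>a \<in> carrier B; b \<in> carrier B; c \<in> carrier B\<rbrakk>
      \<Longrightarrow> a \<otimes> (b \<oplus> c) = (a \<otimes> b \<ominus> a) \<oplus> a \<otimes> c"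

definition brace_lambda :: "('a, 'm) ring_scheme \<Rightarrow> 'a \<Rightarrow> 'a \<Rightarrow> 'a"
  where "brace_lambda B a b = (\<ominus>\<^bsub>B\<^esub> a) \<oplus>\<^bsub>B\<^esub> (a \<otimes>\<^bsub>B\<^esub> b)"

definition brace_star :: "('a, 'm) ring_scheme \<Rightarrow> 'a \<Rightarrow> 'a \<Rightarrow> 'a"
  where "brace_star B a b = brace_lambda B a b \<ominus>\<^bsub>B\<^esub> b"

definition right_Fix :: "('a, 'm) ring_scheme \<Rightarrow> 'a \<Rightarrow> 'a set"
  where "right_Fix B x = {b \<in> carrier B. brace_star B x b = \<zero>\<^bsub>B\<^esub>}"

definition left_Fix :: "('a, 'm) ring_scheme \<Rightarrow> 'a \<Rightarrow> 'a set"
  where "left_Fix B x = {b \<in> carrier B. brace_star B b x = \<zero>\<^bsub>B\<^esub>}"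

definition centraliser :: "('a, 'm) monoid_scheme \<Rightarrow> 'a \<Rightarrow> 'a set"
  where "centraliser G x = {g \<in> carrier G. g \<otimes>\<^bsub>G\<^esub> x = x \<otimes>\<^bsub>G\<^esub> g}"

text \<open>
  The finiteness of an index \<open>|G : H|\<close> is the finiteness of the set of right cosets of \<open>H\<close>
  in \<open>G\<close>; \<^term>\<open>card\<close> would be useless here since it is \<open>0\<close> on infinite sets.
\<close>

definition brace_property_s :: "('a, 'm) ring_scheme \<Rightarrow> 'a \<Rightarrow> bool"
  where "brace_property_s B x \<longleftrightarrow>
    finite (rcosets\<^bsub>add_monoid B\<^esub> (right_Fix B x \<inter> centraliser (add_monoid B) x)) \<and>
    finite (rcosets\<^bsub>B\<^esub> (left_Fix B x \<inter> centraliser B x))"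

definition brace_property_S :: "('a, 'm) ring_scheme \<Rightarrow> bool"
  where "brace_property_S B \<longleftrightarrow> (\<forall>x \<in> carrier B. brace_property_s B x)"

definition sub_skew_brace :: "'a set \<Rightarrow> ('a, 'm) ring_scheme \<Rightarrow> bool"
  where "sub_skew_brace H B \<longleftrightarrow> subgroup H (add_monoid B) \<and> subgroup H B"

text \<open>
  The hull of \<open>E\<close> is the intersection of all sub-skew braces containing \<open>E\<close>; this family
  contains \<^term>\<open>carrier B\<close> because \<open>E \<subseteq> carrier B\<close>.
\<close>

definition fin_gen_skew_brace :: "('a, 'm) ring_scheme \<Rightarrow> bool"
  where "fin_gen_skew_brace B \<longleftrightarrow>
    (\<exists>E. finite E \<and> E \<subseteq> carrier B \<and> (\<lambda>H. sub_skew_brace H B) hull E = carrier B)"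

definition fin_gen_group :: "('a, 'm) monoid_scheme \<Rightarrow> bool"
  where "fin_gen_group G \<longleftrightarrow>
    (\<exists>E. finite E \<and> E \<subseteq> carrier G \<and> generate G E = carrier G)"

context skew_brace
begin

lemmas a_closed = add.m_closed [simplified]
  and a_assoc = add.m_assoc [simplified]
  and zero_in = add.one_closed [simplified]
  and a_lzero = add.l_one [simplified]
  and a_rzero = add.r_one [simplified]
  and neg_closed = add.inv_closed [folded a_inv_def, simplified]
  and l_neg = add.l_inv [folded a_inv_def, simplified]
  and r_neg = add.r_inv [folded a_inv_def, simplified]

lemma one_eq_zero: "\<one> = \<zero>"
proof -
  have "\<one> \<otimes> (\<zero> \<oplus> \<zero>) = (\<one> \<otimes> \<zero> \<ominus> \<one>) \<oplus> \<one> \<otimes> \<zero>"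
    by (rule brace_distrib) (simp_all add: zero_in)
  then have "\<zero> = \<ominus> \<one>"
    by (simp add: a_minus_def a_lzero a_rzero zero_in neg_closed)
  then show ?thesis
    by (metis a_rzero one_closed r_neg)
qed

lemma neg_add_cancel:
  "\<lbrakk>a \<in> carrier B; b \<in> carrier B\<rbrakk> \<Longrightarrow> a \<oplus> (\<ominus> a \<oplus> b) = b"
  by (simp add: a_assoc [symmetric] neg_closed r_neg a_lzero)

lemma star_zero_iff:
  assumes "a \<in> carrier B" "b \<in> carrier B"
  shows "brace_star B a b = \<zero> \<longleftrightarrow> a \<otimes> b = a \<oplus> b"
proof -
  have *: "\<ominus> a \<oplus> a \<otimes> b \<in> carrier B"
    using assms by (simp add: a_closed neg_closed)
  have "brace_star B a b = \<zero> \<longleftrightarrow> \<ominus> a \<oplus> a \<otimes> b = b"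
    using * assms add.r_cancel [of "\<ominus> a \<oplus> a \<otimes> b" "\<ominus> b" b]
    by (simp add: brace_star_def brace_lambda_def a_minus_def neg_closed r_neg)
       (metis a_assoc a_lzero a_rzero l_neg neg_closed r_neg)
  also have "\<dots> \<longleftrightarrow> a \<otimes> b = a \<oplus> b"
    using assms neg_add_cancel [of a "a \<otimes> b"]
    by (metis a_assoc a_lzero l_neg m_closed neg_closed)
  finally show ?thesis .
qed

lemma right_Fix_iff:
  "x \<in> carrier B \<Longrightarrow> b \<in> right_Fix B x \<longleftrightarrow> b \<in> carrier B \<and> x \<otimes> b = x \<oplus> b"
  by (auto simp: right_Fix_def star_zero_iff)

lemma left_Fix_iff:
  "x \<in> carrier B \<Longrightarrow> b \<in> left_Fix B x \<longleftrightarrow> b \<in> carrier B \<and> b \<otimes> x = b \<oplus> x"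
  by (auto simp: left_Fix_def star_zero_iff)

lemma subgroup_right_Fix:
  assumes x: "x \<in> carrier B"
  shows "subgroup (right_Fix B x) (add_monoid B)"
proof (rule add.subgroupI)
  show "right_Fix B x \<subseteq> carrier (add_monoid B)"
    by (auto simp: right_Fix_def)
  have "\<zero> \<in> right_Fix B x"
    using x r_one by (simp add: right_Fix_iff zero_in a_rzero one_eq_zero)
  then show "right_Fix B x \<noteq> {}"
    by auto
next
  fix b assume "b \<in> right_Fix B x"
  then have b: "b \<in> carrier B" "x \<otimes> b = x \<oplus> b"
    using x by (auto simp: right_Fix_iff)
  have "x = x \<otimes> (b \<oplus> \<ominus> b)"
    using x b r_one by (simp add: r_neg one_eq_zero)
  also have "\<dots> = ((x \<oplus> b) \<ominus> x) \<oplus> x \<otimes> \<ominus> b"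
    using x b by (simp add: brace_distrib neg_closed)
  also have "\<dots> = x \<oplus> (b \<oplus> (\<ominus> x \<oplus> x \<otimes> \<ominus> b))"
    using x b by (simp add: a_minus_def a_assoc a_closed neg_closed)
  finally have "\<zero> = b \<oplus> (\<ominus> x \<oplus> x \<otimes> \<ominus> b)"
    using x b by (metis a_assoc a_closed a_lzero l_neg m_closed neg_closed)
  then have "\<ominus> b = \<ominus> x \<oplus> x \<otimes> \<ominus> b"
    using x b by (metis a_assoc a_closed a_lzero a_rzero l_neg m_closed neg_closed)
  then have "x \<otimes> \<ominus> b = x \<oplus> \<ominus> b"
    using x b by (metis neg_add_cancel neg_closed m_closed)
  then have "\<ominus> b \<in> right_Fix B x"
    using x b by (simp add: right_Fix_iff neg_closed)
  then show "inv\<^bsub>add_monoid B\<^esub> b \<in> right_Fix B x"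
    by (simp add: a_inv_def)
next
  fix b c assume "b \<in> right_Fix B x" "c \<in> right_Fix B x"
  then have *: "b \<in> carrier B" "x \<otimes> b = x \<oplus> b" "c \<in> carrier B" "x \<otimes> c = x \<oplus> c"
    using x by (auto simp: right_Fix_iff)
  have "x \<otimes> (b \<oplus> c) = (x \<oplus> b \<ominus> x) \<oplus> (x \<oplus> c)"
    using x * by (simp add: brace_distrib)
  also have "\<dots> = x \<oplus> (b \<oplus> (\<ominus> x \<oplus> (x \<oplus> c)))"
    using x * by (simp add: a_minus_def a_assoc a_closed neg_closed)
  also have "\<ominus> x \<oplus> (x \<oplus> c) = c"
    using x * by (metis a_assoc a_lzero l_neg neg_closed)
  finally show "b \<otimes>\<^bsub>add_monoid B\<^esub> c \<in> right_Fix B x"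
    using x * by (simp add: right_Fix_iff a_closed)
qed

lemma subgroup_left_Fix:
  assumes x: "x \<in> carrier B"
  shows "subgroup (left_Fix B x) B"
proof (rule subgroupI)
  show "left_Fix B x \<subseteq> carrier B"
    by (auto simp: left_Fix_def)
  have "\<one> \<in> left_Fix B x"
    using x a_lzero by (simp add: left_Fix_iff flip: one_eq_zero)
  then show "left_Fix B x \<noteq> {}"
    by auto
next
  fix b assume "b \<in> left_Fix B x"
  then have b: "b \<in> carrier B" "b \<otimes> x = b \<oplus> x"
    using x by (auto simp: left_Fix_iff)
  have "x = inv b \<otimes> (b \<oplus> x)"
    using x b by (metis inv_closed l_inv l_one m_assoc)
  also have "\<dots> = \<ominus> (inv b) \<oplus> inv b \<otimes> x"
    using x b by (simp add: brace_distrib a_minus_def one_eq_zero a_lzero neg_closed)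
  finally have "inv b \<otimes> x = inv b \<oplus> x"
    using x b by (metis neg_add_cancel inv_closed m_closed)
  then show "inv b \<in> left_Fix B x"
    using x b by (simp add: left_Fix_iff)
next
  fix b c assume "b \<in> left_Fix B x" "c \<in> left_Fix B x"
  then have *: "b \<in> carrier B" "b \<otimes> x = b \<oplus> x" "c \<in> carrier B" "c \<otimes> x = c \<oplus> x"
    using x by (auto simp: left_Fix_iff)
  have "b \<otimes> c \<otimes> x = b \<otimes> (c \<oplus> x)"
    using x * by (simp add: m_assoc)
  also have "\<dots> = (b \<otimes> c \<ominus> b) \<oplus> (b \<oplus> x)"
    using x * by (simp add: brace_distrib)
  also have "\<dots> = b \<otimes> c \<oplus> (\<ominus> b \<oplus> (b \<oplus> x))"
    using x * by (simp add: a_minus_def a_assoc a_closed neg_closed)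
  also have "\<ominus> b \<oplus> (b \<oplus> x) = x"
    using x * by (metis a_assoc a_lzero l_neg neg_closed)
  finally show "b \<otimes> c \<in> left_Fix B x"
    using x * by (simp add: left_Fix_iff)
qed

end

lemma (in group) subgroup_centraliser:
  assumes x: "x \<in> carrier G"
  shows "subgroup (centraliser G x) G"
proof (rule subgroupI)
  show "centraliser G x \<subseteq> carrier G"
    by (auto simp: centraliser_def)
  have "\<one> \<in> centraliser G x"
    using x by (simp add: centraliser_def)
  then show "centraliser G x \<noteq> {}"
    by auto
next
  fix g assume "g \<in> centraliser G x"
  then show "inv g \<in> centraliser G x"
    using x by (simp add: centraliser_def)
       (metis inv_closed inv_solve_left inv_solve_right m_assoc m_closed)
next
  fix g h assume "g \<in> centraliser G x" "h \<in> centraliser G x"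
  then show "g \<otimes> h \<in> centraliser G x"
    using x by (simp add: centraliser_def) (metis m_assoc)
qed

end

theory Submission
  imports Defs
begin

text \<open>
  The map \<open>\<lambda>\<close> is an action of the circle group on the additive group by automorphisms, and
  \<open>a \<otimes> b = a \<oplus> \<lambda>\<^sub>a(b)\<close>. Property (S) makes every \<open>\<lambda>\<close>-orbit finite: the
  stabiliser of \<open>x\<close> is \<^term>\<open>left_Fix B x\<close>, which contains a subgroup of finite index.

  Let \<open>B\<close> be generated by a finite set \<open>E\<close> as a skew brace. The union of the \<open>\<lambda>\<close>-orbits of the
  elements of \<open>E\<close> is again finite, and the additive subgroup that it generates is \<open>\<lambda>\<close>-invariant.
  Such a subgroup, a left ideal, is closed under the circle operation and its inverses
  (\<open>left_ideal_circle_subgroup\<close>); so it is a sub-skew brace containing \<open>E\<close>, that is, all of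
  \<open>B\<close>. Hence the additive group is finitely generated, by a finite \<open>\<lambda>\<close>-invariant set
  (\<open>finite_lambda_invariant_generators\<close>).

  The circle group acts on this finite invariant set, and an element that fixes it pointwise acts
  trivially on the whole of \<open>B\<close>. So the kernel \<open>K\<close> of \<open>\<lambda>\<close> has finite index. The two operations
  agree on \<open>K\<close>, and \<open>k \<otimes> b = k \<oplus> b\<close> for \<open>k \<in> K\<close>, so the right cosets of \<open>K\<close> are the same in
  both groups. Schreier's rewriting process now moves a word in the additive generators through a
  finite transversal, and the elements of \<open>K\<close> that it produces may be multiplied with the circle
  operation instead of added (\<open>additive_fg_imp_circle_fg\<close>). Therefore the circle group is
  finitely generated. The implications towards generation as a skew brace hold because a
  sub-skew brace is a subgroup of both groups.
\<close>

section \<open>The lambda action\<close>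

context skew_brace
begin

lemma lambda_closed:
  "\<lbrakk>a \<in> carrier B; b \<in> carrier B\<rbrakk> \<Longrightarrow> brace_lambda B a b \<in> carrier B"
  by (simp add: brace_lambda_def a_closed neg_closed)

lemma circle_eq_add_lambda:
  "\<lbrakk>a \<in> carrier B; b \<in> carrier B\<rbrakk> \<Longrightarrow> a \<otimes> b = a \<oplus> brace_lambda B a b"
  by (simp add: brace_lambda_def neg_add_cancel)

lemma lambda_eq_iff_circle_eq:
  assumes "a \<in> carrier B" "b \<in> carrier B" "c \<in> carrier B"
  shows "brace_lambda B a b = c \<longleftrightarrow> a \<otimes> b = a \<oplus> c"
  using assms add.l_cancel[of a "brace_lambda B a b" c]
  by (auto simp: circle_eq_add_lambda lambda_closed)

lemma lambda_one: "b \<in> carrier B \<Longrightarrow> brace_lambda B \<one> b = b"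
  by (simp add: lambda_eq_iff_circle_eq) (simp add: one_eq_zero a_lzero)

lemma lambda_add:
  assumes "a \<in> carrier B" "b \<in> carrier B" "c \<in> carrier B"
  shows "brace_lambda B a (b \<oplus> c) = brace_lambda B a b \<oplus> brace_lambda B a c"
  using assms by (simp add: brace_lambda_def brace_distrib a_minus_def a_assoc a_closed neg_closed)

lemma lambda_group_hom:
  assumes "a \<in> carrier B"
  shows "group_hom (add_monoid B) (add_monoid B) (brace_lambda B a)"
  by unfold_locales (use assms in \<open>auto simp: hom_def lambda_closed lambda_add\<close>)

lemma lambda_circle:
  assumes "a \<in> carrier B" "b \<in> carrier B" "c \<in> carrier B"
  shows "brace_lambda B (a \<otimes> b) c = brace_lambda B a (brace_lambda B b c)"
proof -
  have "(a \<otimes> b) \<otimes> c = a \<otimes> (b \<oplus> brace_lambda B b c)"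
    using assms by (simp add: m_assoc flip: circle_eq_add_lambda)
  also have "\<dots> = (a \<otimes> b) \<oplus> brace_lambda B a (brace_lambda B b c)"
    using assms
    by (simp add: circle_eq_add_lambda lambda_add a_closed lambda_closed a_assoc)
  finally show ?thesis
    using assms by (simp add: lambda_eq_iff_circle_eq lambda_closed)
qed

text \<open>
  The circle inverse stays in a left ideal because \<open>\<zero> = a\<^sup>-\<^sup>1 \<otimes> a = a\<^sup>-\<^sup>1 \<oplus> \<lambda>(a)\<close>, where \<open>\<lambda>\<close> is
  taken at \<open>a\<^sup>-\<^sup>1\<close>.
\<close>

lemma left_ideal_circle_subgroup:
  assumes H: "subgroup H (add_monoid B)"
    and inv: "\<And>a h. \<lbrakk>a \<in> carrier B; h \<in> H\<rbrakk> \<Longrightarrow> brace_lambda B a h \<in> H"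
  shows "subgroup H B"
proof (rule subgroupI)
  show sub: "H \<subseteq> carrier B" using subgroup.subset[OF H] by simp
  show "H \<noteq> {}" using subgroup.one_closed[OF H] by auto
  show "inv a \<in> H" if "a \<in> H" for a
  proof -
    have a: "a \<in> carrier B" using that sub by auto
    have "inv a \<oplus> brace_lambda B (inv a) a = \<zero>"
      using a by (simp flip: circle_eq_add_lambda add: one_eq_zero)
    then have "inv a = inv\<^bsub>add_monoid B\<^esub> (brace_lambda B (inv a) a)"
      using a add.inv_equality[of "inv a" "brace_lambda B (inv a) a"] by (simp add: lambda_closed)
    then show ?thesis
      using subgroup.m_inv_closed[OF H inv[OF inv_closed[OF a] that]] by simp
  qed
  show "a \<otimes> b \<in> H" if "a \<in> H" "b \<in> H" for a b
  proof -
    have "a \<in> carrier B" "b \<in> carrier B" using that sub by auto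
    then show ?thesis
      using subgroup.m_closed[OF H that(1) inv[of a b]] that by (simp add: circle_eq_add_lambda)
  qed
qed

lemma lambda_orbit_finite:
  assumes x: "x \<in> carrier B" and s: "brace_property_s B x"
  shows "finite ((\<lambda>b. brace_lambda B b x) ` carrier B)"
proof -
  define H where "H = left_Fix B x \<inter> centraliser B x"
  have H: "subgroup H B"
    unfolding H_def using x
    by (intro subgroups_Inter_pair subgroup_left_Fix subgroup_centraliser)
  define f where "f C = brace_lambda B (inv (SOME c. c \<in> C)) x" for C
  have "brace_lambda B b x \<in> f ` (rcosets H)" if b: "b \<in> carrier B" for b
  proof -
    \<comment> \<open>The cosets are right cosets, so the orbit map factors through them only after inversion.\<close>
    let ?C = "H #> inv b"
    have "inv b \<in> ?C" using b H by (simp add: rcos_self)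
    then have "(SOME c. c \<in> ?C) \<in> ?C" by (rule someI)
    then obtain h where h: "h \<in> H" "(SOME c. c \<in> ?C) = h \<otimes> inv b"
      by (auto simp: r_coset_def)
    have hB: "h \<in> carrier B" using h(1) subgroup.subset[OF H] by auto
    have "inv h \<in> left_Fix B x"
      using subgroup.m_inv_closed[OF H h(1)] by (simp add: H_def)
    then have "brace_lambda B (inv h) x = x"
      using x hB by (simp add: left_Fix_iff lambda_eq_iff_circle_eq)
    then have "f ?C = brace_lambda B b x"
      using b hB x by (simp add: f_def h(2) inv_mult_group lambda_circle)
    moreover have "?C \<in> rcosets H"
      using b subgroup.subset[OF H] by (intro rcosetsI) auto
    ultimately show ?thesis by (metis imageI)
  qed
  moreover have "finite (rcosets H)"
    using s by (simp add: brace_property_s_def H_def)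
  ultimately show ?thesis
    by (meson finite_imageI finite_subset image_subsetI)
qed

section \<open>Finite generation of the additive group\<close>

lemma finite_lambda_invariant_generators:
  assumes S: "brace_property_S B" and fg: "fin_gen_skew_brace B"
  obtains E where "finite E" "E \<subseteq> carrier B" "generate (add_monoid B) E = carrier B"
    "\<And>a e. \<lbrakk>a \<in> carrier B; e \<in> E\<rbrakk> \<Longrightarrow> brace_lambda B a e \<in> E"
proof -
  obtain D where D: "finite D" "D \<subseteq> carrier B" "(\<lambda>H. sub_skew_brace H B) hull D = carrier B"
    using fg by (auto simp: fin_gen_skew_brace_def)
  define E where "E = (\<Union>x\<in>D. (\<lambda>b. brace_lambda B b x) ` carrier B)"
  have fin: "finite E"
    unfolding E_def using D S by (auto simp: brace_property_S_def intro!: lambda_orbit_finite)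
  have sub: "E \<subseteq> carrier B" using D by (auto simp: E_def lambda_closed)
  have DE: "D \<subseteq> E"
  proof
    fix x assume "x \<in> D"
    then show "x \<in> E" using D lambda_one[of x] by (force simp: E_def)
  qed
  have invE: "brace_lambda B a e \<in> E" if "a \<in> carrier B" "e \<in> E" for a e
  proof -
    from that(2) obtain x b where xb: "x \<in> D" "b \<in> carrier B" "e = brace_lambda B b x"
      by (auto simp: E_def)
    have "brace_lambda B a e = brace_lambda B (a \<otimes> b) x"
      using xb that D by (auto simp: lambda_circle)
    then show ?thesis using xb that by (auto simp: E_def)
  qed
  let ?A = "generate (add_monoid B) E"
  have A: "subgroup ?A (add_monoid B)" using sub by (simp add: add.generate_is_subgroup)
  have invA: "brace_lambda B a h \<in> ?A" if a: "a \<in> carrier B" and h: "h \<in> ?A" for a h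
  proof -
    interpret L: group_hom "add_monoid B" "add_monoid B" "brace_lambda B a"
      by (rule lambda_group_hom[OF a])
    have "brace_lambda B a h \<in> generate (add_monoid B) (brace_lambda B a ` E)"
      using L.generate_img[of E] sub h by auto
    moreover have "\<dots> \<subseteq> ?A" using invE a by (intro add.mono_generate) auto
    ultimately show ?thesis by blast
  qed
  have "sub_skew_brace ?A B"
    using A left_ideal_circle_subgroup[OF A invA] by (simp add: sub_skew_brace_def)
  moreover have "D \<subseteq> ?A" using DE generate.incl[of _ E "add_monoid B"] by blast
  ultimately have "carrier B \<subseteq> ?A"
    unfolding D(3)[symmetric] by (rule hull_minimal[rotated])
  then have "?A = carrier B" using subgroup.subset[OF A] by auto
  then show thesis using that fin sub invE by blast
qed

section \<open>Finite generation of the circle group\<close>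

lemma subgroup_lambda_kernel:
  "subgroup {k \<in> carrier B. \<forall>b \<in> carrier B. k \<otimes> b = k \<oplus> b} B"
proof -
  have "{k \<in> carrier B. \<forall>b \<in> carrier B. k \<otimes> b = k \<oplus> b} = (\<Inter>b \<in> carrier B. left_Fix B b)"
    using zero_in by (auto simp: left_Fix_iff)
  moreover have "subgroup (\<Inter>b \<in> carrier B. left_Fix B b) B"
    using zero_in by (intro subgroups_Inter) (auto intro: subgroup_left_Fix)
  ultimately show ?thesis by simp
qed

lemma lambda_eq_if_eq_on_generators:
  assumes "a \<in> carrier B" "b \<in> carrier B" "E \<subseteq> carrier B"
    and gen: "generate (add_monoid B) E = carrier B"
    and eq: "\<And>e. e \<in> E \<Longrightarrow> brace_lambda B a e = brace_lambda B b e"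
    and "x \<in> carrier B"
  shows "brace_lambda B a x = brace_lambda B b x"
proof -
  interpret La: group_hom "add_monoid B" "add_monoid B" "brace_lambda B a"
    by (rule lambda_group_hom) fact
  interpret Lb: group_hom "add_monoid B" "add_monoid B" "brace_lambda B b"
    by (rule lambda_group_hom) fact
  have "x \<in> generate (add_monoid B) E" using assms by simp
  then show ?thesis
  proof induction
    case one
    then show ?case using La.hom_one Lb.hom_one by simp
  next
    case (incl h)
    then show ?case by (rule eq)
  next
    case (inv h)
    then show ?case using La.hom_inv[of h] Lb.hom_inv[of h] eq assms(3) by auto
  next
    case (eng h k)
    then have "h \<in> carrier B" "k \<in> carrier B" using gen by auto
    then show ?case using eng assms by (simp add: lambda_add)
  qed
qed

text \<open>
  A finite transversal for the right cosets of the kernel of \<open>\<lambda>\<close> exists because \<open>\<lambda>\<close> is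
  determined by the permutation it induces on a finite invariant set of generators.
\<close>

lemma finite_lambda_kernel_transversal:
  assumes E: "finite E" "E \<subseteq> carrier B" "generate (add_monoid B) E = carrier B"
    and invE: "\<And>a e. \<lbrakk>a \<in> carrier B; e \<in> E\<rbrakk> \<Longrightarrow> brace_lambda B a e \<in> E"
  obtains R where "finite R" "R \<subseteq> carrier B"
    "\<And>b. b \<in> carrier B \<Longrightarrow> \<exists>r\<in>R. \<forall>x \<in> carrier B. (b \<otimes> inv r) \<otimes> x = (b \<otimes> inv r) \<oplus> x"
proof -
  define p where "p b = restrict (brace_lambda B b) E" for b
  have "p ` carrier B \<subseteq> E \<rightarrow>\<^sub>E E" using invE by (auto simp: p_def)
  then have "finite (p ` carrier B)" using E(1) by (meson finite_PiE finite_subset)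
  then obtain R where R: "R \<subseteq> carrier B" "finite R" "p ` carrier B = p ` R"
    using finite_subset_image[of "p ` carrier B" p "carrier B"] by auto
  have "\<exists>r\<in>R. \<forall>x \<in> carrier B. (b \<otimes> inv r) \<otimes> x = (b \<otimes> inv r) \<oplus> x"
    if b: "b \<in> carrier B" for b
  proof -
    obtain r where r: "r \<in> R" "p b = p r" using R b by (metis imageE imageI)
    have rB: "r \<in> carrier B" using r R by auto
    have eq: "brace_lambda B b e = brace_lambda B r e" if "e \<in> E" for e
      using r(2) that by (metis p_def restrict_apply')
    have "(b \<otimes> inv r) \<otimes> x = (b \<otimes> inv r) \<oplus> x" if x: "x \<in> carrier B" for x
    proof -
      have "brace_lambda B (b \<otimes> inv r) x = brace_lambda B b (brace_lambda B (inv r) x)"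
        using b rB x by (simp add: lambda_circle)
      also have "\<dots> = brace_lambda B r (brace_lambda B (inv r) x)"
        using lambda_eq_if_eq_on_generators[OF b rB E(2,3) eq] rB x by (simp add: lambda_closed)
      also have "\<dots> = x"
        using rB x by (simp flip: lambda_circle add: lambda_one)
      finally show ?thesis using b rB x by (simp add: lambda_eq_iff_circle_eq)
    qed
    then show ?thesis using r by blast
  qed
  then show thesis using that R by blast
qed

text \<open>
  Schreier's rewriting process. If \<open>z\<close> denotes the factor from the kernel in \<open>r \<oplus> e = z \<otimes> s\<close>, with
  \<open>r\<close> and \<open>s\<close> in the transversal, then an element \<open>k \<otimes> r\<close> with \<open>k\<close> in the circle group generated by
  these factors satisfies \<open>(k \<otimes> r) \<oplus> e = k \<oplus> (z \<otimes> s) = (k \<otimes> z) \<otimes> s\<close>, because \<open>k\<close> lies in the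
  kernel. So adding generators never leaves the set of these elements.
\<close>

lemma additive_fg_imp_circle_fg:
  assumes E: "finite E" "E \<subseteq> carrier B" "generate (add_monoid B) E = carrier B"
    and invE: "\<And>a e. \<lbrakk>a \<in> carrier B; e \<in> E\<rbrakk> \<Longrightarrow> brace_lambda B a e \<in> E"
  shows "fin_gen_group B"
proof -
  obtain R0 where R0: "finite R0" "R0 \<subseteq> carrier B"
    "\<And>b. b \<in> carrier B \<Longrightarrow> \<exists>r\<in>R0. \<forall>x \<in> carrier B. (b \<otimes> inv r) \<otimes> x = (b \<otimes> inv r) \<oplus> x"
    using finite_lambda_kernel_transversal[OF E invE] by blast
  \<comment> \<open>The rewriting starts at the identity, which need not be among the representatives.\<close>
  define R where "R = insert \<one> R0"
  \<comment> \<open>Words may contain inverses of generators.\<close>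
  define E' where "E' = E \<union> a_inv B ` E"
  define K where "K = {k \<in> carrier B. \<forall>b \<in> carrier B. k \<otimes> b = k \<oplus> b}"
  define Z where "Z = (\<lambda>(r, e, s). (r \<oplus> e) \<otimes> inv s) ` (R \<times> E' \<times> R) \<inter> K"
  define T where "T = {k \<otimes> r |k r. k \<in> generate B Z \<and> r \<in> R}"
  have RB: "R \<subseteq> carrier B" using R0 by (auto simp: R_def)
  have E'B: "E' \<subseteq> carrier B" using E by (auto simp: E'_def neg_closed)
  have ZK: "Z \<subseteq> K" and KB: "K \<subseteq> carrier B" by (auto simp: Z_def K_def)
  have ZB: "Z \<subseteq> carrier B" using ZK KB by auto
  have "finite (R \<times> E' \<times> R)" using R0 E by (auto simp: R_def E'_def)
  then have finZ: "finite Z" by (simp add: Z_def)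
  have genK: "generate B Z \<subseteq> K"
    using generate_subgroup_incl[OF ZK] subgroup_lambda_kernel by (simp add: K_def)
  have step: "y \<oplus> e \<in> T" if y: "y \<in> T" and e: "e \<in> E'" for y e
  proof -
    obtain k r where k: "k \<in> generate B Z" and r: "r \<in> R" and ykr: "y = k \<otimes> r"
      using y by (auto simp: T_def)
    have kK: "k \<in> K" and kB: "k \<in> carrier B" using k genK KB by auto
    have rB: "r \<in> carrier B" and eB: "e \<in> carrier B" using r e RB E'B by auto
    obtain s where s: "s \<in> R"
      "\<forall>x \<in> carrier B. ((r \<oplus> e) \<otimes> inv s) \<otimes> x = ((r \<oplus> e) \<otimes> inv s) \<oplus> x"
      using R0(3)[OF a_closed[OF rB eB]] by (auto simp: R_def)
    have sB: "s \<in> carrier B" using s RB by auto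
    define z where "z = (r \<oplus> e) \<otimes> inv s"
    have zB: "z \<in> carrier B" using rB eB sB by (simp add: z_def a_closed)
    have zK: "z \<in> K" using s(2) zB by (simp add: K_def z_def)
    then have zZ: "z \<in> Z" using r e s(1) by (force simp: Z_def z_def)
    have zs: "z \<otimes> s = r \<oplus> e" using rB eB sB by (simp add: z_def m_assoc a_closed)
    have "y \<oplus> e = k \<oplus> (r \<oplus> e)"
      using kK kB rB eB by (simp add: ykr K_def a_assoc)
    also have "\<dots> = k \<otimes> (z \<otimes> s)"
      using kK zB sB by (simp add: K_def flip: zs)
    also have "\<dots> = (k \<otimes> z) \<otimes> s" using kB zB sB by (simp add: m_assoc)
    finally have "y \<oplus> e = (k \<otimes> z) \<otimes> s" .
    moreover have "k \<otimes> z \<in> generate B Z" using k zZ by (auto intro: generate.intros)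
    ultimately show ?thesis using s(1) by (auto simp: T_def)
  qed
  have TB: "T \<subseteq> carrier B" using genK KB RB by (auto simp: T_def)
  have "\<forall>y \<in> T. y \<oplus> b \<in> T" if "b \<in> generate (add_monoid B) E" for b
    using that
  proof induction
    case one
    then show ?case using TB by (auto simp: a_rzero)
  next
    case (incl h)
    then show ?case using step by (auto simp: E'_def)
  next
    case (inv h)
    then show ?case using step by (auto simp: E'_def a_inv_def)
  next
    case (eng h k)
    then have "h \<in> carrier B" "k \<in> carrier B" using E(3) by auto
    then show ?case using eng TB by (auto simp flip: a_assoc)
  qed
  moreover have "\<one> \<in> T"
    using generate.one[of B Z] by (force simp: T_def R_def)
  ultimately have "b \<in> T" if "b \<in> carrier B" for b
    using that E(3) a_lzero[of b] by (metis one_eq_zero)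
  moreover have "T \<subseteq> generate B (Z \<union> R)"
  proof -
    have "generate B Z \<subseteq> generate B (Z \<union> R)" by (intro mono_generate) auto
    then show ?thesis by (auto simp: T_def intro: generate.intros)
  qed
  ultimately have "carrier B \<subseteq> generate B (Z \<union> R)" by blast
  moreover have "generate B (Z \<union> R) \<subseteq> carrier B" using ZB RB by (intro generate_incl) auto
  ultimately show ?thesis
    unfolding fin_gen_group_def using finZ R0(1) ZB RB
    by (intro exI[of _ "Z \<union> R"]) (auto simp: R_def)
qed

lemma fin_gen_skew_braceI:
  assumes "finite E" "E \<subseteq> carrier B"
    and "\<And>H. \<lbrakk>sub_skew_brace H B; E \<subseteq> H\<rbrakk> \<Longrightarrow> carrier B \<subseteq> H"
  shows "fin_gen_skew_brace B"
proof -
  have "sub_skew_brace (carrier B) B"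
    using subgroup_self add.subgroup_self by (simp add: sub_skew_brace_def)
  then have "(\<lambda>H. sub_skew_brace H B) hull E = carrier B"
    using assms by (intro hull_unique) auto
  then show ?thesis using assms(1,2) by (auto simp: fin_gen_skew_brace_def)
qed

end

section \<open>The equivalence\<close>

theorem theorem3p13:
  fixes B :: "('a, 'm) ring_scheme"
  assumes "skew_brace B"
    and "brace_property_S B"
  shows "(fin_gen_skew_brace B \<longleftrightarrow> fin_gen_group (add_monoid B)) \<and>
         (fin_gen_group (add_monoid B) \<longleftrightarrow> fin_gen_group B)"
proof -
  interpret skew_brace B by fact
  have "fin_gen_group (add_monoid B) \<and> fin_gen_group B" if fg: "fin_gen_skew_brace B"
  proof -
    obtain E where "finite E" "E \<subseteq> carrier B" "generate (add_monoid B) E = carrier B"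
      "\<And>a e. \<lbrakk>a \<in> carrier B; e \<in> E\<rbrakk> \<Longrightarrow> brace_lambda B a e \<in> E"
      using finite_lambda_invariant_generators[OF assms(2) fg] by blast
    then show ?thesis
      using additive_fg_imp_circle_fg[of E] by (auto simp: fin_gen_group_def)
  qed
  moreover have "fin_gen_skew_brace B" if "fin_gen_group (add_monoid B)"
  proof -
    obtain E where "finite E" "E \<subseteq> carrier B" "generate (add_monoid B) E = carrier B"
      using \<open>fin_gen_group (add_monoid B)\<close> by (auto simp: fin_gen_group_def)
    then show ?thesis
      using add.generate_subgroup_incl[of E]
      by (intro fin_gen_skew_braceI[of E]) (auto simp: sub_skew_brace_def)
  qed
  moreover have "fin_gen_skew_brace B" if "fin_gen_group B"
  proof -
    obtain E where "finite E" "E \<subseteq> carrier B" "generate B E = carrier B"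
      using \<open>fin_gen_group B\<close> by (auto simp: fin_gen_group_def)
    then show ?thesis
      using generate_subgroup_incl[of E]
      by (intro fin_gen_skew_braceI[of E]) (auto simp: sub_skew_brace_def)
  qed
  ultimately show ?thesis by blast
qed

end
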